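(* Let $q$ be a prime power, $n\ge4$ an integer and $2\le k\le\lfloor n/2\rfloor$. Then the number $\mathcal{N}_q(k,n)$ of $q$-matroids of rank $k$ on $\mathbb{F}_q^n$ satisfies \[ 2^{q^{(n-k)(k-1)}}<\mathcal{N}_q(k,n). \]
   Context: A $q$-matroid on $E=\mathbb{F}_q^n$ is a function $\rho$ from the set of all $\mathbb{F}_q$-subspaces of $E$ to $\mathbb{Z}_{\ge0}$ such that for all subspaces $X,Y$: $0\le\rho(X)\le\dim X$; $X\le Y$ implies $\rho(X)\le\rho(Y)$; and $\rho(X\cap Y)+\rho(X+Y)\le\rho(X)+\rho(Y)$. Its rank is $\rho(E)$; distinct $q$-matroids are distinct functions. *)

theory Defs
  imports "HOL-Analysis.Analysis"
begin

text \<open>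
  The space \<open>E\<close> over the field of order \<open>q\<close> is the type \<open>'a^'n\<close>
  with \<open>'a :: {field,finite}\<close>, \<open>CARD('a) = q\<close> and \<open>CARD('n) = n\<close>.
  A rank function is only meaningful on subspaces: extensionality fixes its value on all other
  sets, so that two q-matroids are equal as HOL functions iff they agree on every subspace.
\<close>

definition q_matroid :: "(('a::{field,finite}^'n) set \<Rightarrow> nat) \<Rightarrow> bool" where
  "q_matroid \<rho> \<longleftrightarrow>
     \<rho> \<in> extensional {X. vec.subspace X} \<and>
     (\<forall>X. vec.subspace X \<longrightarrow> 0 \<le> \<rho> X \<and> \<rho> X \<le> vec.dim X) \<and>
     (\<forall>X Y. vec.subspace X \<longrightarrow> vec.subspace Y \<longrightarrow> X \<subseteq> Y \<longrightarrow> \<rho> X \<le> \<rho> Y) \<and>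
     (\<forall>X Y. vec.subspace X \<longrightarrow> vec.subspace Y \<longrightarrow>
        \<rho> (X \<inter> Y) + \<rho> {x + y |x y. x \<in> X \<and> y \<in> Y} \<le> \<rho> X + \<rho> Y)"

definition q_matroid_rank :: "(('a::{field,finite}^'n) set \<Rightarrow> nat) \<Rightarrow> nat" where
  "q_matroid_rank \<rho> = \<rho> UNIV"

definition q_matroids_of_rank :: "nat \<Rightarrow> (('a::{field,finite}^'n) set \<Rightarrow> nat) set" where
  "q_matroids_of_rank k = {\<rho>. q_matroid \<rho> \<and> q_matroid_rank \<rho> = k}"

end

theory Submission
  imports Defs "HOL-Algebra.Algebraic_Closure_Type"
begin

text \<open>
  A family \<open>S\<close> of \<open>k\<close>-dimensional subspaces meeting pairwise in dimension at most \<open>k - 2\<close> yields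
  \<open>2 ^ card S\<close> q-matroids of rank \<open>k\<close>: on any subfamily, lower the uniform rank
  \<open>min (dim U) k\<close> to \<open>k - 1\<close>. Such a family is a lifted maximum rank distance code. With
  \<open>m = n - k\<close>, a \<open>k \<times> m\<close> matrix \<open>M\<close> is lifted to its graph in \<open>E\<close>, and two graphs meet in
  dimension at most \<open>k - 2\<close> iff the difference of the matrices has rank at least 2. Take
  elements \<open>a\<^sub>i\<close> and \<open>b\<^sub>j\<close> of the field of order \<open>q ^ m\<close>, each family independent
  over the ground field; then
  \<open>M \<mapsto> \<Sum>\<^sub>i\<^sub>j M\<^sub>i\<^sub>j a\<^sub>i b\<^sub>j\<close> does not vanish on matrices of rank 1, and by the pigeonhole
  principle one of its fibres has at least \<open>q ^ (m * (k - 1))\<close> elements. A \<open>k\<close>-dimensional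
  subspace of the complementary coordinate space meets all graphs trivially; adding it to the
  family makes the inequality strict.
\<close>

subsection \<open>Subfields of the algebraic closure of a finite field\<close>

text \<open>Multiplication by a nonzero \<open>x\<close> permutes the nonzero elements; comparing
  their product before and after leaves a factor \<open>x ^ (q - 1)\<close>, which must be
  1.\<close>

lemma finite_field_power_card: "x ^ CARD('a) = (x :: 'a :: {field,finite})"
proof (cases "x = 0")
  case False
  let ?P = "\<Prod>y\<in>UNIV - {0::'a}. y"
  have bij: "bij_betw ((*) x) (UNIV - {0}) (UNIV - {0})"
    using False by (intro bij_betwI[where g = "\<lambda>y. y / x"]) auto
  have "?P = (\<Prod>y\<in>UNIV - {0}. x * y)"
    by (rule prod.reindex_bij_betw[OF bij, symmetric])
  also have "\<dots> = x ^ (CARD('a) - 1) * ?P"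
    by (simp add: prod.distrib card_Diff_singleton)
  finally have "x ^ (CARD('a) - 1) = 1"
    by simp
  then show ?thesis
    using power_minus_mult[of "CARD('a)" x] by (simp add: zero_less_card_finite)
qed simp

text \<open>The polynomial \<open>(X + 1)\<^sup>q - X\<^sup>q - 1\<close> has degree less than \<open>q\<close> and vanishes at all \<open>q\<close>
  elements of the field, so all its coefficients vanish.\<close>

lemma of_nat_card_choose_eq_0:
  assumes "0 < i" "i < CARD('a)"
  shows "of_nat (CARD('a) choose i) = (0 :: 'a :: {field,finite})"
proof -
  let ?q = "CARD('a)"
  define p :: "'a poly" where "p = (\<Sum>i\<in>{1..<?q}. Polynomial.monom (of_nat (?q choose i)) i)"
  have "poly p x = 0" for x
  proof -
    have "{..?q} = insert 0 (insert ?q {1..<?q})"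
      by auto
    then have "(x + 1) ^ ?q = 1 + (x ^ ?q + poly p x)"
      by (simp add: binomial_ring p_def poly_sum poly_monom)
    then show ?thesis
      by (simp add: finite_field_power_card)
  qed
  moreover have "Polynomial.degree p < ?q"
    unfolding p_def by (rule degree_sum_less) (auto intro: le_less_trans[OF Polynomial.degree_monom_le])
  ultimately have "p = 0"
    using card_poly_roots_bound[of p] by fastforce
  then have "Polynomial.coeff p i = 0"
    by simp
  then show ?thesis
    using assms by (simp add: p_def coeff_sum sum.delta)
qed

lemma two_le_card_field: "2 \<le> CARD('a :: {field,finite})"
  using card_mono[of UNIV "{0, 1 :: 'a}"] by simp

lemma of_nat_card_alg_closure: "of_nat CARD('a) = (0 :: 'a :: {field,finite} alg_closure)"
proof -
  \<comment> \<open>The case \<open>i = 1\<close> of the vanishing binomial coefficients says that q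
    itself is zero.\<close>
  have "of_nat (CARD('a) choose 1) = (0 :: 'a)"
    using two_le_card_field[where 'a = 'a] by (intro of_nat_card_choose_eq_0) auto
  then show ?thesis
    by (metis choose_one to_ac_0 to_ac_of_nat)
qed

text \<open>The inner binomial coefficients vanish in the ground field, hence in its closure;
  induction on \<open>m\<close> iterates the case of a single q-th power.\<close>

lemma alg_closure_frobenius_add:
  "(x + y) ^ CARD('a) ^ m = x ^ CARD('a) ^ m + (y :: 'a :: {field,finite} alg_closure) ^ CARD('a) ^ m"
proof (induction m)
  case (Suc m)
  let ?q = "CARD('a)"
  have eq: "(u + v) ^ ?q = u ^ ?q + v ^ ?q" for u v :: "'a alg_closure"
  proof -
    have 0: "of_nat (?q choose i) = (0 :: 'a alg_closure)" if "i \<in> {1..<?q}" for i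
      using of_nat_card_choose_eq_0[of i, where 'a = 'a] that
      by (metis atLeastLessThan_iff less_eq_Suc_le One_nat_def to_ac_0 to_ac_of_nat)
    have "{..?q} = insert 0 (insert ?q {1..<?q})"
      by auto
    then show ?thesis
      by (simp add: binomial_ring 0)
  qed
  show ?case
    by (simp add: power_mult mult.commute[of ?q] Suc eq)
qed simp

section \<open>The subfield of order q^m as a set of roots\<close>

text \<open>A double root would also be a root of the derivative. So the multiset of roots has no
  repetitions, and its size, the degree, counts distinct roots.\<close>

lemma card_roots_alg_closed:
  fixes p :: "'a :: alg_closed_field poly"
  assumes "p \<noteq> 0" and simple: "\<And>x. poly p x = 0 \<Longrightarrow> poly (pderiv p) x \<noteq> 0"
  shows "card {x. poly p x = 0} = Polynomial.degree p"
proof -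
  obtain A where A: "size A = Polynomial.degree p" "p = Polynomial.smult (Polynomial.lead_coeff p) (\<Prod>x\<in>#A. [:-x, 1:])"
    using alg_closed_imp_factorization[OF assms(1)] by blast
  have root: "poly p x = 0 \<longleftrightarrow> x \<in># A" for x
    by (subst A(2)) (use assms(1) in \<open>auto simp: poly_prod_mset prod_mset_zero_iff\<close>)
  have "count A x \<le> 1" for x
  proof (rule ccontr)
    assume "\<not> count A x \<le> 1"
    then have "{#x, x#} \<subseteq># A"
      by (auto simp: subseteq_mset_def)
    then obtain B where "A = {#x, x#} + B"
      using subset_mset.le_iff_add by blast
    then have "p = [:-x, 1:] * ([:-x, 1:] * Polynomial.smult (Polynomial.lead_coeff p) (\<Prod>x\<in>#B. [:-x, 1:]))"
      using A(2) by simp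
    then obtain r where "p = [:-x, 1:] * ([:-x, 1:] * r)"
      by blast
    then have "poly p x = 0" "poly (pderiv p) x = 0"
      by (simp_all add: pderiv_mult del: mult_pCons_left)
    then show False
      using simple by blast
  qed
  then have "A = mset_set (set_mset A)"
    by (intro multiset_eqI) (simp add: count_mset_set' not_in_iff le_antisym Suc_le_eq)
  then have "card (set_mset A) = size A"
    by (metis size_mset_set)
  then show ?thesis
    using A(1) by (simp add: root)
qed

text \<open>For \<open>m > 0\<close> this is the field of order q^m, realised as the fixed points of
  the m-th Frobenius power.\<close>

definition alg_closure_subfield :: "nat \<Rightarrow> 'a :: {field,finite} alg_closure set" where
  "alg_closure_subfield m = {x. x ^ CARD('a) ^ m = x}"

text \<open>The elements are the roots of X^Q - X with Q = q^m. Since \<open>m > 0\<close>, Q is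
  zero in the closure, so the derivative is -1 and every root is simple.\<close>

lemma card_alg_closure_subfield:
  assumes "m > 0"
  shows "card (alg_closure_subfield m :: 'a :: {field,finite} alg_closure set) = CARD('a) ^ m"
proof -
  let ?Q = "CARD('a) ^ m"
  define p :: "'a alg_closure poly" where "p = Polynomial.monom 1 ?Q - Polynomial.monom 1 1"
  have Q: "?Q > 1"
    using two_le_card_field[where 'a = 'a] assms by (intro one_less_power) auto
  then have deg: "Polynomial.degree p = ?Q"
    unfolding p_def diff_conv_add_uminus by (subst degree_add_eq_left) (auto simp: Polynomial.degree_monom_eq)
  have "of_nat ?Q = (0 :: 'a alg_closure)"
    using assms by (simp add: of_nat_card_alg_closure)
  then have "pderiv p = -1"
    by (simp add: p_def pderiv_diff pderiv_monom del: of_nat_power)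
  then have "card {x. poly p x = 0} = ?Q"
    using deg Q by (subst card_roots_alg_closed) auto
  then show ?thesis
    by (simp add: p_def alg_closure_subfield_def poly_monom)
qed

lemma alg_closure_subfield_closed:
  fixes x y :: "'a :: {field,finite} alg_closure"
  shows "0 \<in> (alg_closure_subfield m :: 'a alg_closure set)"
    and "to_ac (c :: 'a) \<in> alg_closure_subfield m"
    and "\<lbrakk>x \<in> alg_closure_subfield m; y \<in> alg_closure_subfield m\<rbrakk> \<Longrightarrow> x + y \<in> alg_closure_subfield m"
    and "\<lbrakk>x \<in> alg_closure_subfield m; y \<in> alg_closure_subfield m\<rbrakk> \<Longrightarrow> x * y \<in> alg_closure_subfield m"
proof -
  have "c ^ CARD('a) ^ m = c"
    by (induction m) (simp_all add: power_mult finite_field_power_card)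
  then show "to_ac (c :: 'a) \<in> alg_closure_subfield m"
    by (simp add: alg_closure_subfield_def flip: to_ac_power)
qed (auto simp: alg_closure_subfield_def power_mult_distrib alg_closure_frobenius_add)

lemma alg_closure_subfield_sum:
  assumes "\<And>i. i \<in> I \<Longrightarrow> f i \<in> alg_closure_subfield m"
  shows "sum f I \<in> alg_closure_subfield m"
  using assms by (induction I rule: infinite_finite_induct) (auto intro: alg_closure_subfield_closed)

section \<open>Linear independence over the ground field\<close>

interpretation alg_closure: vector_space "\<lambda>(a :: 'a :: field) x. to_ac a * x"
  by unfold_locales (simp_all add: algebra_simps)

lemma (in vector_space) card_span_le:
  fixes B :: "'b set"
  assumes "finite (UNIV :: 'a set)" "finite B"
  shows "finite (span B)" and "card (span B) \<le> CARD('a) ^ card B"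
proof -
  have sub: "span B \<subseteq> (\<lambda>u. \<Sum>v\<in>B. scale (u v) v) ` (B \<rightarrow>\<^sub>E UNIV)"
  proof
    fix x assume "x \<in> span B"
    then obtain u where "x = (\<Sum>v\<in>B. scale (u v) v)"
      using span_finite[OF assms(2)] by auto
    then have "x = (\<Sum>v\<in>B. scale (restrict u B v) v)"
      by simp
    then show "x \<in> (\<lambda>u. \<Sum>v\<in>B. scale (u v) v) ` (B \<rightarrow>\<^sub>E UNIV)"
      by (intro image_eqI[where x = "restrict u B"]) simp_all
  qed
  moreover have fin: "finite (B \<rightarrow>\<^sub>E (UNIV :: 'a set))"
    using assms by (intro finite_PiE)
  ultimately show "finite (span B)"
    by (rule finite_surj[rotated])
  have "card (span B) \<le> card (B \<rightarrow>\<^sub>E (UNIV :: 'a set))"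
    using fin sub by (rule surj_card_le)
  then show "card (span B) \<le> CARD('a) ^ card B"
    using assms by (simp add: card_PiE)
qed

text \<open>A maximal independent subset \<open>B\<close> of the field spans it, and a span has at
  most \<open>q ^ card B\<close> elements, so \<open>B\<close> has at least \<open>m\<close>.
  Independence refers to the indexed family, which rules out repetitions and fits matrix
  coefficients.\<close>

lemma alg_closure_subfield_independent:
  fixes J :: "'j set"
  assumes "finite J" "card J \<le> m" "m > 0"
  obtains b :: "'j \<Rightarrow> 'a :: {field,finite} alg_closure"
  where "b ` J \<subseteq> alg_closure_subfield m"
    and "\<forall>c. (\<Sum>j\<in>J. to_ac (c j) * b j) = 0 \<longrightarrow> (\<forall>j\<in>J. c j = 0)"
proof -
  let ?K = "alg_closure_subfield m :: 'a alg_closure set"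
  have K: "card ?K = CARD('a) ^ m" "finite ?K"
    using card_alg_closure_subfield[OF assms(3), where 'a = 'a] by (auto intro!: card_ge_0_finite)
  obtain B where B: "B \<subseteq> ?K" "alg_closure.independent B" "?K \<subseteq> alg_closure.span B"
    using alg_closure.maximal_independent_subset by blast
  have finB: "finite B"
    using B(1) K(2) finite_subset by blast
  have "CARD('a) ^ m \<le> CARD('a) ^ card B"
    using alg_closure.card_span_le[OF finite finB] card_mono[OF _ B(3)] K(1) by (metis le_trans)
  then have "m \<le> card B"
    using two_le_card_field[where 'a = 'a] by (simp add: power_le_imp_le_exp)
  then obtain b where b: "b ` J \<subseteq> B" "inj_on b J"
    using card_le_inj[OF assms(1) finB] assms(2) by auto
  show thesis
  proof (rule that)
    show "b ` J \<subseteq> ?K"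
      using b B by blast
    have "c i = 0" if *: "(\<Sum>j\<in>J. to_ac (c j :: 'a) * b j) = 0" "i \<in> J" for c i
    proof -
      \<comment> \<open>The coefficients are reindexed by the vectors themselves, as independence of
        the set \<open>B\<close> requires.\<close>
      have "(\<Sum>v\<in>b ` J. to_ac (c (the_inv_into J b v)) * v) = 0"
        using *(1) b(2) by (simp add: sum.reindex the_inv_into_f_f)
      then have "c (the_inv_into J b (b i)) = 0"
        using alg_closure.independentD[of B "b ` J" "\<lambda>v. c (the_inv_into J b v)" "b i"] B(2) b *(2) assms(1)
        by auto
      then show ?thesis
        using b(2) *(2) by (simp add: the_inv_into_f_f)
    qed
    then show "\<forall>c. (\<Sum>j\<in>J. to_ac (c j :: 'a) * b j) = 0 \<longrightarrow> (\<forall>j\<in>J. c j = 0)"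
      by blast
  qed
qed

subsection \<open>q-matroids from sparse families of subspaces\<close>

text \<open>For a sparse family \<open>T\<close> and 0 < k < n, the members of \<open>T\<close>
  become circuit-hyperplanes: this is the q-analogue of a sparse paving matroid. The restricted
  lambda supplies the required extensionality.\<close>

definition sparse_rank :: "nat \<Rightarrow> ('a::{field,finite}^'n) set set \<Rightarrow> ('a^'n) set \<Rightarrow> nat" where
  "sparse_rank k T = (\<lambda>U\<in>{U. vec.subspace U}. if U \<in> T then k - 1 else min (vec.dim U) k)"

definition sparse_family :: "nat \<Rightarrow> ('a::{field,finite}^'n) set set \<Rightarrow> bool" where
  "sparse_family k S \<longleftrightarrow>
     (\<forall>U\<in>S. vec.subspace U \<and> vec.dim U = k) \<and>
     pairwise (\<lambda>U V. vec.dim (U \<inter> V) + 2 \<le> k) S"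

lemma dim_less_subspace:
  fixes U V :: "('a::field^'n) set"
  assumes "vec.subspace U" "vec.subspace V" "U \<subset> V"
  shows "vec.dim U < vec.dim V"
  using assms vec.dim_psubset[of U V] by (metis vec.span_eq_iff)

text \<open>Submodularity is delicate only for incomparable \<open>U\<close> and \<open>V\<close>.
  If one of them is lowered, the strictly smaller dimension of the intersection makes up for the
  loss of 1. If both are, the right side is 2k - 2, and sparsity bounds the left side by (k - 2) +
  k.\<close>

lemma q_matroid_sparse_rank:
  assumes "sparse_family k T" "k > 0"
  shows "q_matroid (sparse_rank k T)"
proof -
  have T: "vec.dim U = k" if "U \<in> T" for U
    using assms(1) that by (auto simp: sparse_family_def)
  have submod: "sparse_rank k T (U \<inter> V) + sparse_rank k T {x + y |x y. x \<in> U \<and> y \<in> V}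
      \<le> sparse_rank k T U + sparse_rank k T V"
    if U: "vec.subspace U" and V: "vec.subspace V" for U V
  proof -
    let ?W = "{x + y |x y. x \<in> U \<and> y \<in> V}"
    have W: "vec.subspace ?W" and I: "vec.subspace (U \<inter> V)"
      using U V by (simp_all add: vec.subspace_sums vec.subspace_inter)
    have dim: "vec.dim ?W + vec.dim (U \<inter> V) = vec.dim U + vec.dim V"
      using U V by (rule vec.dim_sums_Int)
    consider "U \<subseteq> V" | "V \<subseteq> U" | "\<not> U \<subseteq> V" "\<not> V \<subseteq> U"
      by blast
    then show ?thesis
    proof cases
      case 1
      then have "U \<inter> V = U" "?W = V"
        using vec.subspace_0[OF U] vec.subspace_add[OF V] by (auto, metis add_0)
      then show ?thesis
        by simp
    next
      case 2
      then have "U \<inter> V = V" "?W = U"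
        using vec.subspace_0[OF V] vec.subspace_add[OF U] by (auto, metis add.right_neutral)
      then show ?thesis
        by simp
    next
      case 3
      then have "U \<inter> V \<subset> U" "U \<inter> V \<subset> V"
        by auto
      then have "vec.dim (U \<inter> V) < vec.dim U" "vec.dim (U \<inter> V) < vec.dim V"
        using dim_less_subspace I U V by blast+
      moreover have "vec.dim (U \<inter> V) + 2 \<le> k" if "U \<in> T" "V \<in> T"
        using that 3 assms(1) by (auto simp: sparse_family_def pairwise_def)
      ultimately show ?thesis
        using dim T[of U] T[of V] T[of ?W] T[of "U \<inter> V"] U V W I assms(2)
        by (auto simp: sparse_rank_def min_def split: if_splits)
    qed
  qed
  have mono: "sparse_rank k T U \<le> sparse_rank k T V"
    if "vec.subspace U" "vec.subspace V" "U \<subseteq> V" for U V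
  proof (cases "U = V")
    case False
    then have "vec.dim U < vec.dim V"
      using that dim_less_subspace[of U V] by blast
    then show ?thesis
      using that T[of U] T[of V] by (auto simp: sparse_rank_def)
  qed simp
  have "sparse_rank k T U \<le> vec.dim U" if "vec.subspace U" for U
    using that T[of U] by (simp add: sparse_rank_def)
  with submod mono show ?thesis
    by (simp add: q_matroid_def sparse_rank_def)
qed

text \<open>\<open>T\<close> is recovered as the set of k-dimensional subspaces of rank
  \<open>k - 1\<close>; \<open>k > 0\<close> keeps \<open>k - 1\<close> distinct from
  \<open>k\<close>.\<close>

lemma sparse_rank_inj:
  assumes "sparse_family k S" "k > 0"
  shows "inj_on (sparse_rank k) (Pow S)"
proof (rule inj_on_inverseI)
  fix T assume T: "T \<in> Pow S"
  then have "vec.subspace U" "vec.dim U = k" if "U \<in> T" for U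
    using that assms(1) by (auto simp: sparse_family_def)
  moreover have "U \<in> T" if "vec.subspace U" "vec.dim U = k" "sparse_rank k T U = k - 1" for U
    using that assms(2) by (simp add: sparse_rank_def split: if_splits)
  moreover have "sparse_rank k T U = k - 1" if "U \<in> T" for U
    using that calculation(1) by (simp add: sparse_rank_def)
  ultimately show "{U. vec.subspace U \<and> vec.dim U = k \<and> sparse_rank k T U = k - 1} = T"
    by blast
qed

section \<open>Counting q-matroids of a given rank\<close>

text \<open>Finiteness makes \<open>card\<close> monotone here, as \<open>card\<close> of an
  infinite set would be 0.\<close>

lemma finite_q_matroids_of_rank:
  "finite (q_matroids_of_rank k :: (('a::{field,finite}^'n) set \<Rightarrow> nat) set)"
proof (rule finite_subset)
  show "q_matroids_of_rank k \<subseteq> {U :: ('a^'n) set. vec.subspace U} \<rightarrow>\<^sub>E {..CARD('n)}"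
  proof
    fix \<rho> :: "('a^'n) set \<Rightarrow> nat"
    assume "\<rho> \<in> q_matroids_of_rank k"
    then have \<rho>: "q_matroid \<rho>"
      by (simp add: q_matroids_of_rank_def)
    have "\<rho> U \<le> CARD('n)" if "vec.subspace U" for U
      using \<rho> that vec.dim_subset_UNIV[of U] by (auto simp: q_matroid_def vec.dimension_def card_cart_basis intro: order_trans)
    with \<rho> show "\<rho> \<in> {U. vec.subspace U} \<rightarrow>\<^sub>E {..CARD('n)}"
      by (auto simp: q_matroid_def PiE_iff)
  qed
qed (intro finite_PiE; simp)

lemma card_q_matroids_of_rank_ge:
  fixes S :: "('a::{field,finite}^'n) set set"
  assumes "sparse_family k S" "0 < k" "k < CARD('n)"
  shows "2 ^ card S \<le> card (q_matroids_of_rank k :: (('a^'n) set \<Rightarrow> nat) set)"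
proof -
  have dim: "vec.dim (UNIV :: ('a^'n) set) = CARD('n)"
    by (simp add: card_cart_basis)
  have "sparse_rank k ` Pow S \<subseteq> q_matroids_of_rank k"
  proof
    fix \<rho> assume "\<rho> \<in> sparse_rank k ` Pow S"
    then obtain T where T: "T \<subseteq> S" "\<rho> = sparse_rank k T"
      by auto
    then have sparse: "sparse_family k T"
      using assms(1) pairwise_subset[OF _ T(1)] by (simp add: sparse_family_def subset_iff)
    \<comment> \<open>Members of \<open>T\<close> have dimension \<open>k < n\<close>, so the whole
      space is not lowered and the rank remains \<open>k\<close>.\<close>
    then have "UNIV \<notin> T"
      using dim assms(3) by (auto simp: sparse_family_def)
    then have "\<rho> UNIV = k"
      using T(2) dim assms(3) by (simp add: sparse_rank_def)
    then show "\<rho> \<in> q_matroids_of_rank k"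
      using T(2) q_matroid_sparse_rank[OF sparse assms(2)]
      by (simp add: q_matroids_of_rank_def q_matroid_rank_def)
  qed
  then have "card (sparse_rank k ` Pow S) \<le> card (q_matroids_of_rank k :: (('a^'n) set \<Rightarrow> nat) set)"
    by (rule card_mono[OF finite_q_matroids_of_rank])
  then show ?thesis
    using sparse_rank_inj[OF assms(1,2)] by (simp add: card_image card_Pow)
qed

subsection \<open>Lifted rank metric codes\<close>

definition coord_subspace :: "'n set \<Rightarrow> ('a::field^'n) set" where
  "coord_subspace d = {v. \<forall>i. i \<notin> d \<longrightarrow> v $ i = 0}"

lemma subspace_coord_subspace: "vec.subspace (coord_subspace d)"
  by (rule vec.subspaceI) (simp_all add: coord_subspace_def)

lemma dim_coord_subspace: "vec.dim (coord_subspace d :: ('a::field^'n) set) = card d"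
  unfolding coord_subspace_def by (rule dim_substandard_cart)

lemma card_coord_subspace:
  "card (coord_subspace d :: ('a::{field,finite}^'n::finite) set) = CARD('a) ^ card d"
proof -
  let ?f = "\<lambda>g. \<chi> i. if i \<in> d then g i else (0 :: 'a)"
  have "bij_betw ?f (d \<rightarrow>\<^sub>E UNIV) (coord_subspace d)"
    by (rule bij_betwI[where g = "\<lambda>v. restrict (($) v) d"])
      (auto simp: coord_subspace_def vec_eq_iff PiE_iff extensional_def fun_eq_iff)
  then have "card (coord_subspace d :: ('a^'n) set) = card (d \<rightarrow>\<^sub>E (UNIV :: 'a set))"
    by (rule bij_betw_same_card[symmetric])
  then show ?thesis
    by (simp add: card_PiE)
qed

text \<open>A matrix is given by its rows \<open>M i\<close> for \<open>i\<close> in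
  \<open>W\<close>, each meant to be supported off \<open>W\<close>. The result is the row space of
  the block matrix [I | M].\<close>

definition graph_space :: "'n set \<Rightarrow> ('n \<Rightarrow> 'a^'n) \<Rightarrow> ('a::field^'n::finite) set" where
  "graph_space W M = (\<lambda>z. z + (\<Sum>i\<in>W. z $ i *s M i)) ` coord_subspace W"

context
  fixes W :: "'n::finite set" and M :: "'n \<Rightarrow> 'a::field^'n"
  assumes M: "\<And>i. i \<in> W \<Longrightarrow> M i \<in> coord_subspace (- W)"
begin

text \<open>The rows of \<open>M\<close> vanish on \<open>W\<close>, so \<open>z\<close> can be read
  off from its image.\<close>

lemma graph_map_nth:
  assumes "l \<in> W"
  shows "(z + (\<Sum>i\<in>W. z $ i *s M i)) $ l = z $ l"
proof -
  have "(\<Sum>i\<in>W. z $ i * M i $ l) = 0"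
    using M assms by (intro sum.neutral) (simp add: coord_subspace_def)
  then show ?thesis
    by simp
qed

lemma linear_graph_map: "Vector_Spaces.linear (*s) (*s) (\<lambda>z. z + (\<Sum>i\<in>W. z $ i *s M i))"
  by (intro Vector_Spaces.linear_iff[THEN iffD2] conjI allI vec.vector_space_axioms)
    (simp_all add: vec.scale_left_distrib vec.scale_right_distrib sum.distrib vec.scale_sum_right)

lemma subspace_graph_space: "vec.subspace (graph_space W M)"
  unfolding graph_space_def
  by (rule vec.linear_subspace_image[OF linear_graph_map subspace_coord_subspace])

lemma graph_map_inj: "inj_on (\<lambda>z. z + (\<Sum>i\<in>W. z $ i *s M i)) (coord_subspace W)"
proof (rule inj_onI)
  fix y z :: "'a^'n"
  assume yz: "y \<in> coord_subspace W" "z \<in> coord_subspace W"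
    and "y + (\<Sum>i\<in>W. y $ i *s M i) = z + (\<Sum>i\<in>W. z $ i *s M i)"
  then have "y $ l = z $ l" if "l \<in> W" for l
    using graph_map_nth[OF that, of y] graph_map_nth[OF that, of z] by simp
  moreover have "y $ l = z $ l" if "l \<notin> W" for l
    using yz that by (simp add: coord_subspace_def)
  ultimately show "y = z"
    unfolding vec_eq_iff by blast
qed

lemma dim_graph_space: "vec.dim (graph_space W M) = card W"
proof -
  have "inj_on (\<lambda>z. z + (\<Sum>i\<in>W. z $ i *s M i)) (vec.span (coord_subspace W))"
    unfolding vec.span_eq_iff[THEN iffD2, OF subspace_coord_subspace] by (rule graph_map_inj)
  then show ?thesis
    unfolding graph_space_def
    by (rule trans[OF vec.dim_image_eq[OF linear_graph_map] dim_coord_subspace])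
qed

lemma axis_add_in_graph_space:
  assumes "i \<in> W"
  shows "axis i 1 + M i \<in> graph_space W M"
proof -
  have "(\<Sum>l\<in>W. axis i 1 $ l *s M l) = (\<Sum>l\<in>W. if l = i then M l else 0)"
    by (intro sum.cong) (auto simp: axis_def)
  also have "\<dots> = M i"
    using assms by (simp add: sum.delta)
  finally show ?thesis
    using assms unfolding graph_space_def
    by (intro image_eqI[where x = "axis i 1"]) (auto simp: coord_subspace_def axis_def)
qed

lemma graph_space_Int_coord_subspace:
  assumes "d \<subseteq> - W"
  shows "graph_space W M \<inter> coord_subspace d \<subseteq> {0}"
proof
  fix v assume v: "v \<in> graph_space W M \<inter> coord_subspace d"
  then obtain z where z: "z \<in> coord_subspace W" "v = z + (\<Sum>i\<in>W. z $ i *s M i)"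
    by (auto simp: graph_space_def)
  have "z $ l = 0" if "l \<in> W" for l
    using graph_map_nth[OF that, of z] v that assms unfolding z(2)[symmetric]
    by (auto simp: coord_subspace_def)
  then have "z = 0"
    using z(1) by (auto simp: coord_subspace_def vec_eq_iff)
  then show "v \<in> {0}"
    by (simp add: z(2))
qed

end

text \<open>The vectors of the graph of \<open>M\<close> over the axes \<open>i\<close> and
  \<open>j\<close> are independent modulo the graph of \<open>N\<close>, so they enlarge the
  intersection by two dimensions inside the graph of \<open>M\<close>.\<close>

lemma dim_graph_space_Int:
  fixes M N :: "'n::finite \<Rightarrow> 'a::field^'n"
  assumes M: "\<And>i. i \<in> W \<Longrightarrow> M i \<in> coord_subspace (- W)"
    and N: "\<And>i. i \<in> W \<Longrightarrow> N i \<in> coord_subspace (- W)"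
    and ij: "i \<in> W" "j \<in> W"
    and indep: "\<And>c c'. c *s (M i - N i) + c' *s (M j - N j) = 0 \<Longrightarrow> c = 0 \<and> c' = 0"
  shows "vec.dim (graph_space W M \<inter> graph_space W N) + 2 \<le> card W"
proof -
  let ?I = "graph_space W M \<inter> graph_space W N"
  define u where "u = axis i 1 + M i"
  define v where "v = axis j 1 + M j"
  have N_sub: "vec.subspace (graph_space W N)"
    using N by (rule subspace_graph_space)
  have J_sub: "vec.subspace (coord_subspace (- W) :: ('a^'n) set)"
    by (rule subspace_coord_subspace)
  have I: "vec.subspace ?I"
    using subspace_graph_space[of W M, OF M] N_sub by (rule vec.subspace_inter)
  have uv: "u \<in> graph_space W M" "v \<in> graph_space W M"
    unfolding u_def v_def using axis_add_in_graph_space[of W M, OF M] ij by auto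
  have uv_N: "axis i 1 + N i \<in> graph_space W N" "axis j 1 + N j \<in> graph_space W N"
    using axis_add_in_graph_space[of W N, OF N] ij by auto
  have coeff_0: "c = 0 \<and> c' = 0" if "c *s u + c' *s v \<in> graph_space W N" for c c'
  proof -
    let ?w = "c *s (M i - N i) + c' *s (M j - N j)"
    \<comment> \<open>Subtracting the same combination for \<open>N\<close> cancels the axis
      vectors, so \<open>?w\<close> lies both in the graph of \<open>N\<close> and off
      \<open>W\<close>.\<close>
    have "?w = (c *s u + c' *s v) - (c *s (axis i 1 + N i) + c' *s (axis j 1 + N j))"
      by (simp add: u_def v_def vec.scale_right_distrib vec.scale_right_diff_distrib)
    also have "\<dots> \<in> graph_space W N"
      by (rule vec.subspace_diff[OF N_sub that vec.subspace_add[OF N_sub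
            vec.subspace_scale[OF N_sub uv_N(1)] vec.subspace_scale[OF N_sub uv_N(2)]]])
    finally have "?w \<in> graph_space W N" .
    moreover have "?w \<in> coord_subspace (- W)"
      by (rule vec.subspace_add[OF J_sub
            vec.subspace_scale[OF J_sub vec.subspace_diff[OF J_sub M[OF ij(1)] N[OF ij(1)]]]
            vec.subspace_scale[OF J_sub vec.subspace_diff[OF J_sub M[OF ij(2)] N[OF ij(2)]]]])
    ultimately have "?w = 0"
      using graph_space_Int_coord_subspace[of W N "- W", OF N] by blast
    then show ?thesis
      by (rule indep)
  qed
  have span_I: "vec.span ?I = ?I"
    using I by (rule vec.span_eq_iff[THEN iffD2])
  have "u \<notin> vec.span ?I"
    using coeff_0[of 1 0] unfolding span_I by auto
  moreover have "v \<notin> vec.span (insert u ?I)"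
  proof
    assume "v \<in> vec.span (insert u ?I)"
    then obtain c where "v - c *s u \<in> ?I"
      unfolding vec.span_insert span_I by blast
    then show False
      using coeff_0[of "- c" 1] by (simp add: add.commute)
  qed
  ultimately have "vec.dim ?I + 2 = vec.dim (insert v (insert u ?I))"
    by (simp add: vec.dim_insert)
  also have "vec.dim (insert v (insert u ?I)) \<le> vec.dim (graph_space W M)"
    using uv by (intro vec.dim_subset) auto
  finally show ?thesis
    using dim_graph_space[of W M, OF M] by simp
qed

section \<open>The code of minimum rank distance 2 and its sparse family\<close>

text \<open>If all rows of \<open>D\<close> were multiples \<open>\<lambda>\<^sub>i D\<^sub>l\<close> of one row, the syndrome would factor as
  \<open>(\<Sum>\<^sub>i \<lambda>\<^sub>i a\<^sub>i) (\<Sum>\<^sub>j D\<^sub>l\<^sub>j b\<^sub>j)\<close>, a product of two nonzero elements of a field.\<close>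

lemma zero_syndrome_independent_rows:
  fixes a b :: "'n::finite \<Rightarrow> 'a::field alg_closure" and D :: "'n \<Rightarrow> 'a^'n"
  assumes a: "\<forall>c. (\<Sum>i\<in>W. to_ac (c i) * a i) = 0 \<longrightarrow> (\<forall>i\<in>W. c i = 0)"
    and b: "\<forall>c. (\<Sum>j\<in>J. to_ac (c j) * b j) = 0 \<longrightarrow> (\<forall>j\<in>J. c j = 0)"
    and D: "D l \<in> coord_subspace J"
    and syndrome: "(\<Sum>i\<in>W. a i * (\<Sum>j\<in>J. to_ac (D i $ j) * b j)) = 0"
    and l: "l \<in> W" "D l \<noteq> 0"
  obtains i where "i \<in> W" "\<And>c c'. c *s D l + c' *s D i = 0 \<Longrightarrow> c = 0 \<and> c' = 0"
proof -
  let ?\<beta> = "\<lambda>v :: 'a^'n. \<Sum>j\<in>J. to_ac (v $ j) * b j"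
  have "\<exists>i\<in>W. \<forall>c c'. c *s D l + c' *s D i = 0 \<longrightarrow> c = 0 \<and> c' = 0"
  proof (rule ccontr)
    assume dep: "\<not> ?thesis"
    have "\<exists>c. D i = c *s D l" if i: "i \<in> W" for i
    proof -
      obtain c c' where c: "c *s D l + c' *s D i = 0" "\<not> (c = 0 \<and> c' = 0)"
        using dep i by blast
      have "c' \<noteq> 0"
        using c l(2) by auto
      have "D i = (- c / c') *s D l"
        unfolding vec_eq_iff
      proof
        fix j
        have "c * D l $ j + c' * D i $ j = 0"
          using arg_cong[OF c(1), of "\<lambda>v. v $ j"] by simp
        then show "D i $ j = ((- c / c') *s D l) $ j"
          using \<open>c' \<noteq> 0\<close> by (simp add: field_simps eq_neg_iff_add_eq_0)
      qed
      then show ?thesis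
        by blast
    qed
    then obtain r where r: "\<And>i. i \<in> W \<Longrightarrow> D i = r i *s D l"
      by metis
    have "?\<beta> (D i) = to_ac (r i) * ?\<beta> (D l)" if "i \<in> W" for i
      unfolding r[OF that] vector_smult_component to_ac_mult mult.assoc
      by (rule sum_distrib_left[symmetric])
    then have "(\<Sum>i\<in>W. a i * ?\<beta> (D i)) = (\<Sum>i\<in>W. to_ac (r i) * a i * ?\<beta> (D l))"
      by (intro sum.cong) (simp_all only: mult_ac)
    also have "\<dots> = (\<Sum>i\<in>W. to_ac (r i) * a i) * ?\<beta> (D l)"
      by (rule sum_distrib_right[symmetric])
    finally have "(\<Sum>i\<in>W. a i * ?\<beta> (D i)) = (\<Sum>i\<in>W. to_ac (r i) * a i) * ?\<beta> (D l)" .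
    then consider "(\<Sum>i\<in>W. to_ac (r i) * a i) = 0" | "?\<beta> (D l) = 0"
      using syndrome by auto
    then show False
    proof cases
      case 1
      then show False
        using a[rule_format, of r l] r[of l] l by simp
    next
      case 2
      then have "D l $ j = 0" for j
        using b[rule_format, of "\<lambda>j. D l $ j" j] D by (cases "j \<in> J") (auto simp: coord_subspace_def)
      then show False
        using l(2) by (simp add: vec_eq_iff)
    qed
  qed
  then show thesis
    using that by blast
qed

text \<open>The bound 2k <= n enters as k <= n - k. It provides k independent elements in a field of
  degree n - k, and a k-element set of coordinates outside \<open>W\<close>.\<close>

lemma exists_sparse_family:
  assumes "2 \<le> k" "2 * k \<le> CARD('n::finite)"
  obtains S :: "('a::{field,finite}^'n) set set"
  where "sparse_family k S" "CARD('a) ^ ((CARD('n) - k) * (k - 1)) < card S"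
proof -
  let ?q = "CARD('a)" and ?m = "CARD('n) - k"
  obtain W :: "'n set" where W: "card W = k"
    using obtain_subset_with_card_n[of k "UNIV :: 'n set"] assms by auto
  define J where "J = - W"
  have card_J: "card J = ?m"
    by (simp add: J_def Compl_eq_Diff_UNIV card_Diff_subset W)
  have m: "k \<le> ?m" "?m > 0"
    using assms by auto
  let ?K = "alg_closure_subfield ?m :: 'a alg_closure set"
  obtain a :: "'n \<Rightarrow> 'a alg_closure" where a: "a ` W \<subseteq> ?K"
    "\<forall>c. (\<Sum>i\<in>W. to_ac (c i) * a i) = 0 \<longrightarrow> (\<forall>i\<in>W. c i = 0)"
    by (rule alg_closure_subfield_independent[of W ?m]) (use W m in auto)
  obtain b :: "'n \<Rightarrow> 'a alg_closure" where b: "b ` J \<subseteq> ?K"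
    "\<forall>c. (\<Sum>j\<in>J. to_ac (c j) * b j) = 0 \<longrightarrow> (\<forall>j\<in>J. c j = 0)"
    by (rule alg_closure_subfield_independent[of J ?m]) (use card_J m in auto)
  \<comment> \<open>All matrices; extensionality off \<open>W\<close> makes distinct ones differ in
    a row.\<close>
  define P :: "('n \<Rightarrow> 'a^'n) set" where "P = (W \<rightarrow>\<^sub>E coord_subspace J)"
  have P: "M i \<in> coord_subspace (- W)" if "M \<in> P" "i \<in> W" for M i
    using that by (auto simp: P_def J_def)
  have "card P = ?q ^ (?m * k)"
    by (simp add: P_def card_PiE card_coord_subspace card_J W power_mult)
  also have "?m * k = ?m * (k - 1) + ?m"
    using assms(1) by (cases k) auto
  finally have card_P: "card P = ?q ^ (?m * (k - 1)) * ?q ^ ?m"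
    by (simp add: power_add)
  define s where "s M = (\<Sum>i\<in>W. a i * (\<Sum>j\<in>J. to_ac (M i $ j) * b j))" for M :: "'n \<Rightarrow> 'a^'n"
  have "s M \<in> ?K" for M
    unfolding s_def
    by (intro alg_closure_subfield_sum alg_closure_subfield_closed subsetD[OF a(1)] subsetD[OF b(1)] imageI)
  then have "s \<in> P \<rightarrow> ?K"
    by blast
  moreover have card_K: "card ?K = ?q ^ ?m"
    using m(2) by (rule card_alg_closure_subfield)
  then have "finite ?K"
    by (auto intro!: card_ge_0_finite)
  moreover have "?K \<noteq> {}"
    using alg_closure_subfield_closed(1) by blast
  moreover have "finite P"
    unfolding P_def by (intro finite_PiE) auto
  \<comment> \<open>Only differences of matrices matter later, so any large fibre serves, not just
    the kernel of \<open>s\<close>.\<close>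
  ultimately obtain y where "card (s -` {y} \<inter> P) * card ?K \<ge> card P"
    using pigeonhole_card[of s P ?K] by blast
  moreover define C where "C = s -` {y} \<inter> P"
  ultimately have card_C: "card C \<ge> ?q ^ (?m * (k - 1))"
    by (simp add: card_P card_K)
  have C_P: "M \<in> P" if "M \<in> C" for M
    using that by (simp add: C_def)
  have finite_C: "finite C"
    using \<open>finite P\<close> by (simp add: C_def)
  have C: "vec.dim (graph_space W M \<inter> graph_space W N) + 2 \<le> k"
    if MN: "M \<in> C" "N \<in> C" "M \<noteq> N" for M N
  proof -
    have "s M = s N"
      using MN by (simp add: C_def)
    then have syndrome: "(\<Sum>i\<in>W. a i * (\<Sum>j\<in>J. to_ac ((M i - N i) $ j) * b j)) = 0"
      by (simp add: s_def left_diff_distrib right_diff_distrib sum_subtractf)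
    obtain l where l: "l \<in> W" "M l - N l \<noteq> 0"
      using MN(3) PiE_ext[of M W "\<lambda>_. coord_subspace J" N] C_P[OF MN(1)] C_P[OF MN(2)]
      unfolding P_def by auto
    have "M l - N l \<in> coord_subspace J"
      unfolding J_def
      by (rule vec.subspace_diff[OF subspace_coord_subspace
            P[OF C_P[OF MN(1)] l(1)] P[OF C_P[OF MN(2)] l(1)]])
    then obtain i where i: "i \<in> W"
      "\<And>c c'. c *s (M l - N l) + c' *s (M i - N i) = 0 \<Longrightarrow> c = 0 \<and> c' = 0"
      by (rule zero_syndrome_independent_rows[where D = "\<lambda>i. M i - N i", OF a(2) b(2) _ syndrome l]) blast
    show ?thesis
      unfolding W[symmetric]
      using P[OF C_P[OF MN(1)]] P[OF C_P[OF MN(2)]] l(1) i by (rule dim_graph_space_Int)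
  qed
  \<comment> \<open>The extra member: its intersections with the graphs have dimension 0, which is
    at most k - 2 since k >= 2.\<close>
  obtain d where d: "d \<subseteq> J" "card d = k"
    using obtain_subset_with_card_n[of k J] m(1) card_J by auto
  let ?U = "coord_subspace d :: ('a^'n) set"
  have graph_U: "vec.dim (graph_space W M \<inter> ?U) = 0" if "M \<in> C" for M
    using graph_space_Int_coord_subspace[of W M d] P[OF C_P[OF that]] d(1)
    unfolding vec.dim_eq_0 J_def by blast
  have graph_dim: "vec.subspace (graph_space W M)" "vec.dim (graph_space W M) = k" if "M \<in> C" for M
    using subspace_graph_space[of W M] dim_graph_space[of W M] P[OF C_P[OF that]] W by auto
  have U_dim: "vec.dim ?U = k"
    using d(2) by (simp add: dim_coord_subspace)
  have U_notin: "?U \<notin> graph_space W ` C"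
  proof
    assume "?U \<in> graph_space W ` C"
    then obtain M where "M \<in> C" "graph_space W M = ?U"
      by blast
    then show False
      using graph_U[of M] U_dim assms(1) by simp
  qed
  have inj: "inj_on (graph_space W) C"
  proof (rule inj_onI, rule ccontr)
    fix M N assume MN: "M \<in> C" "N \<in> C" "graph_space W M = graph_space W N" "M \<noteq> N"
    \<comment> \<open>Equal graphs of distinct matrices would have an intersection of dimension k,
      not at most k - 2.\<close>
    then have "vec.dim (graph_space W M) + 2 \<le> k"
      using C[of M N] by simp
    then show False
      using graph_dim(2)[OF MN(1)] by simp
  qed
  let ?S = "insert ?U (graph_space W ` C)"
  show thesis
  proof (rule that)
    have "vec.subspace V \<and> vec.dim V = k" if "V \<in> ?S" for V
      using that graph_dim U_dim subspace_coord_subspace by auto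
    moreover have "pairwise (\<lambda>U V. vec.dim (U \<inter> V) + 2 \<le> k) (graph_space W ` C)"
    proof (rule pairwiseI)
      fix U V assume "U \<in> graph_space W ` C" "V \<in> graph_space W ` C" "U \<noteq> V"
      then obtain M N where "M \<in> C" "N \<in> C" "M \<noteq> N" "U = graph_space W M" "V = graph_space W N"
        by auto
      then show "vec.dim (U \<inter> V) + 2 \<le> k"
        using C by simp
    qed
    moreover have "vec.dim (?U \<inter> V) + 2 \<le> k \<and> vec.dim (V \<inter> ?U) + 2 \<le> k"
      if V: "V \<in> graph_space W ` C" for V
    proof -
      obtain M where "M \<in> C" "V = graph_space W M"
        using V by blast
      then show ?thesis
        using graph_U[of M] assms(1) by (simp add: Int_commute[of ?U] del: vec.dim_eq_0)
    qed
    ultimately show "sparse_family k ?S"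
      unfolding sparse_family_def pairwise_insert by blast
    show "?q ^ (?m * (k - 1)) < card ?S"
      using card_C finite_C U_notin card_image[OF inj] by simp
  qed
qed

theorem theorem3p5:
  fixes q n k :: nat
  assumes "CARD('a::{field,finite}) = q"
    and "CARD('n::finite) = n"
    and "n \<ge> 4"
    and "2 \<le> k" and "k \<le> n div 2"
  shows "2 ^ (q ^ ((n - k) * (k - 1))) < card (q_matroids_of_rank k :: (('a^'n) set \<Rightarrow> nat) set)"
proof -
  have k: "2 * k \<le> CARD('n)" "k < CARD('n)"
    using assms by auto
  obtain S :: "('a^'n) set set" where S: "sparse_family k S" "q ^ ((n - k) * (k - 1)) < card S"
    using exists_sparse_family[OF assms(4) k(1)] assms(1,2) by metis
  then have "(2::nat) ^ (q ^ ((n - k) * (k - 1))) < 2 ^ card S"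
    by simp
  also have "\<dots> \<le> card (q_matroids_of_rank k :: (('a^'n) set \<Rightarrow> nat) set)"
    using S(1) assms(4) k(2) by (intro card_q_matroids_of_rank_ge) auto
  finally show ?thesis .
qed

end
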